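(* Let $0<q<1$, $0<\alpha\le 1$, $n_0\in\mathbb{Z}$, $a=q^{n_0}$, and $\Lambda_a=\{q^{n_0},q^{n_0-1},q^{n_0-2},\ldots\}$. Let $v$ and $\mu$ be nonnegative real valued functions on $\Lambda_a$ such that $$0\le \mu(t)<\frac{1}{t^{\alpha}(1-q)^{\alpha}}\quad\text{for all } t\in\Lambda_a$$ (in particular if $0\le\mu(t)<\frac{1}{(1-q)^{\alpha}}$), and $$v(t)\le v(a)+{}_q\nabla_a^{-\alpha}(v\mu)(t)\quad\text{for all } t\in\Lambda_a.$$ Then $$v(t)\le v(a)\sum_{k=0}^{\infty}\big({}_q\Omega_\mu^{k}1\big)(t)\quad\text{for all } t\in\Lambda_a.$$
   Context: Nabla $q$-integral: for $t=q^m\in\Lambda_a$ (so $m\le n_0$) and $f:\Lambda_a\to\mathbb{R}$, $\int_a^t f(s)\nabla_q s=(1-q)\sum_{j=m}^{n_0-1}q^{j}f(q^{j})$, which is $0$ when $t=a$. (This is the difference $\int_0^t-\int_0^a$ of the integrals $\int_0^t f(s)\nabla_q s=(1-q)t\sum_{i\ge0}q^i f(tq^i)$.) $q$-factorial function: for real $\beta$ and $t\neq 0$, $(t-s)_q^{\beta}=t^{\beta}\prod_{i=0}^{\infty}\frac{1-\frac{s}{t}q^{i}}{1-\frac{s}{t}q^{i+\beta}}$. In particular $(t-qs)_q^{\alpha-1}=t^{\alpha-1}\prod_{i=0}^{\infty}\frac{1-\frac{s}{t}q^{i+1}}{1-\frac{s}{t}q^{i+\alpha}}$. $q$-Gamma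 function: $\Gamma_q(\alpha)=\frac{(1-q)_q^{\alpha-1}}{(1-q)^{\alpha-1}}=(1-q)^{1-\alpha}\prod_{i=0}^{\infty}\frac{1-q^{i+1}}{1-q^{i+\alpha}}$ for $\alpha>0$. Left $q$-fractional integral of order $\alpha$ starting at $a$: ${}_q\nabla_a^{-\alpha}f(t)=\frac{1}{\Gamma_q(\alpha)}\int_a^t(t-qs)_q^{\alpha-1}f(s)\nabla_q s$. Operator ${}_q\Omega_x$: for a function $x$ on $\Lambda_a$, $({}_q\Omega_x\phi)(t)={}_q\nabla_a^{-\alpha}(x\phi)(t)$. ${}_q\Omega_x^{k}$ is its $k$-fold iterate (${}_q\Omega_x^0$ is the identity), and $1$ denotes the constant function $1$.
   Formalization: The parenthetical "in particular if 0≤μ(t)<1/(1-q)^α" is dropped: for t>1 it does not imply the displayed bound on μ, and the series can then diverge; only the displayed bound is assumed. *)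

theory Defs
  imports "HOL-Analysis.Infinite_Products"
begin

definition q_time_scale :: "real \<Rightarrow> int \<Rightarrow> real set" where
  "q_time_scale q n0 = {q powi m | m. m \<le> n0}"

definition q_exponent :: "real \<Rightarrow> real \<Rightarrow> int" where
  "q_exponent q t = (THE m. t = q powi m)"

text \<open>Both limits are meant to be integer powers of \<open>q\<close>. Since \<open>0 < q < 1\<close>, a lower
  limit \<open>a \<le> t\<close> has the larger exponent. The sum contains the endpoint \<open>t\<close> but not
  \<open>a\<close>, so that a function only matters through its values on the time scale.\<close>

definition q_nabla_integral :: "real \<Rightarrow> real \<Rightarrow> real \<Rightarrow> (real \<Rightarrow> real) \<Rightarrow> real" where
  "q_nabla_integral q a t f =
     (1 - q) * (\<Sum>j = q_exponent q t..q_exponent q a - 1. q powi j * f (q powi j))"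

text \<open>This is \<open>(t - s)\<^sub>q\<^sup>\<beta>\<close> for \<open>t > 0\<close>, provided that no denominator
  vanishes. On the time scale it is only needed for \<open>q * s\<close> with \<open>s \<le> t\<close> and for
  \<open>\<beta> = \<alpha> - 1\<close> with \<open>\<alpha> > 0\<close>, where all denominators are positive.\<close>

definition q_factorial :: "real \<Rightarrow> real \<Rightarrow> real \<Rightarrow> real \<Rightarrow> real" where
  "q_factorial q t s \<beta> =
     t powr \<beta> * (\<Prod>i. (1 - s / t * q ^ i) / (1 - s / t * q powr (real i + \<beta>)))"

definition q_Gamma :: "real \<Rightarrow> real \<Rightarrow> real" where
  "q_Gamma q \<alpha> = q_factorial q 1 q (\<alpha> - 1) / (1 - q) powr (\<alpha> - 1)"

definition q_fractional_integral ::
  "real \<Rightarrow> real \<Rightarrow> real \<Rightarrow> (real \<Rightarrow> real) \<Rightarrow> real \<Rightarrow> real" where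
  "q_fractional_integral q a \<alpha> f t =
     1 / q_Gamma q \<alpha> * q_nabla_integral q a t (\<lambda>s. q_factorial q t (q * s) (\<alpha> - 1) * f s)"

definition q_Omega ::
  "real \<Rightarrow> real \<Rightarrow> real \<Rightarrow> (real \<Rightarrow> real) \<Rightarrow> (real \<Rightarrow> real) \<Rightarrow> real \<Rightarrow> real" where
  "q_Omega q a \<alpha> x \<phi> = q_fractional_integral q a \<alpha> (\<lambda>s. x s * \<phi> s)"

lemma q_exponent_powi:
  assumes "0 < q" "q < 1"
  shows "q_exponent q (q powi m) = m"
proof -
  have "k = m" if "q powi m = q powi k" for k
  proof -
    have "q powr real_of_int m = q powr real_of_int k"
      using that assms(1) powr_real_of_int'[of q m] powr_real_of_int'[of q k] by linarith
    then show ?thesis using assms by (simp add: powr_inj)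
  qed
  then show ?thesis unfolding q_exponent_def by (intro the_equality) auto
qed

lemma q_nabla_integral_powi:
  assumes "0 < q" "q < 1"
  shows "q_nabla_integral q (q powi n0) (q powi m) f =
    (1 - q) * (\<Sum>j = m..n0 - 1. q powi j * f (q powi j))"
  using assms by (simp add: q_nabla_integral_def q_exponent_powi)

lemma q_Gamma_eq:
  assumes "0 < q" "q < 1"
  shows "q_Gamma q \<alpha> = (1 - q) powr (1 - \<alpha>) *
    (\<Prod>i. (1 - q ^ (i + 1)) / (1 - q powr (real i + \<alpha>)))"
proof -
  have "q * q powr (real i + (\<alpha> - 1)) = q powr (real i + \<alpha>)" for i
    using powr_mult_base[of q "real i + (\<alpha> - 1)"] assms by (simp add: add.commute)
  moreover have "1 / (1 - q) powr (\<alpha> - 1) = (1 - q) powr (1 - \<alpha>)"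
    using powr_minus_divide[of "1 - q" "\<alpha> - 1"] by simp
  ultimately show ?thesis
    by (simp only: q_Gamma_def q_factorial_def powr_one_eq_one div_by_1 mult_1 power_Suc
        Suc_eq_plus1[symmetric] divide_inverse) simp
qed

end

theory Submission
  imports Defs
begin

text \<open>In the exponents of \<open>q\<close>, the operator \<open>q_Omega\<close> is given by a nonnegative
  kernel that is triangular, and the bound on \<open>\<mu>\<close> says exactly that its diagonal entries are
  less than \<open>1\<close>: the infinite product at \<open>s = t\<close> is the one in the \<open>q\<close>-Gamma function,
  so that \<open>((1 - q) * t) powr \<alpha>\<close> remains. Hence, by induction on the distance to the endpoint
  \<open>a\<close>, the Neumann series converges at every point, its sum \<open>S\<close> satisfies
  \<open>S = 1 + \<Omega> S\<close>, and \<open>e = v - v a * S\<close> satisfies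
  \<open>e \<le> \<Omega> e\<close>, which forces \<open>e \<le> 0\<close>.\<close>

section \<open>Triangular operators with diagonal entries below 1\<close>

text \<open>Indices are exponents of \<open>q\<close>, so a smaller index is a later time and
  \<open>n\<close> is the endpoint \<open>a\<close>. The sum contains the diagonal
  \<open>j = m\<close> and is empty at \<open>m = n\<close>.\<close>

definition triangular_op ::
  "(int \<Rightarrow> int \<Rightarrow> real) \<Rightarrow> int \<Rightarrow> (int \<Rightarrow> real) \<Rightarrow> int \<Rightarrow> real" where
  "triangular_op w n f m = (\<Sum>j = m..n - 1. w m j * f j)"

lemma triangular_op_split:
  assumes "m < n"
  shows "triangular_op w n f m = w m m * f m + (\<Sum>j = m + 1..n - 1. w m j * f j)"
proof -
  have "{m..n - 1} = insert m {m + 1..n - 1}" using assms by auto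
  then show ?thesis unfolding triangular_op_def by (simp only:) simp
qed

lemma int_down_induct [consumes 1, case_names less]:
  fixes m n :: int
  assumes "m \<le> n" and "\<And>m. m \<le> n \<Longrightarrow> (\<And>j. m < j \<Longrightarrow> j \<le> n \<Longrightarrow> P j) \<Longrightarrow> P m"
  shows "P m"
  using assms(1)
proof (induction "nat (n - m)" arbitrary: m rule: less_induct)
  case less
  show ?case by (rule assms(2)[OF less.prems less.hyps]) auto
qed

text \<open>Summing the recursion bounds the partial sums:
  \<open>s (Suc K) = x 0 + d * s K + (\<Sum>k<K. b k)\<close> and \<open>s K \<le> s (Suc K)\<close>
  give \<open>(1 - d) * s K \<le> x 0 + suminf b\<close>. Below, \<open>d\<close> is a diagonal
  entry and \<open>b\<close> collects the contributions of earlier points.\<close>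

lemma summable_affine_recursion:
  fixes x b :: "nat \<Rightarrow> real"
  assumes d: "0 \<le> d" "d < 1" and x: "\<And>k. 0 \<le> x k" and b: "\<And>k. 0 \<le> b k" "summable b"
    and rec: "\<And>k. x (Suc k) = d * x k + b k"
  shows "summable x"
proof (rule summableI_nonneg_bounded[where x = "(x 0 + suminf b) / (1 - d)"])
  fix K
  have "(\<Sum>k<Suc K. x k) = x 0 + d * (\<Sum>k<K. x k) + (\<Sum>k<K. b k)"
    by (simp add: sum.lessThan_Suc_shift rec sum.distrib sum_distrib_left del: sum.lessThan_Suc)
  moreover have "(\<Sum>k<K. b k) \<le> suminf b" using b by (intro sum_le_suminf) auto
  moreover have "(\<Sum>k<K. x k) \<le> (\<Sum>k<Suc K. x k)" using x by simp
  ultimately have "(1 - d) * (\<Sum>k<K. x k) \<le> x 0 + suminf b" by (simp add: algebra_simps)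
  then show "(\<Sum>k<K. x k) \<le> (x 0 + suminf b) / (1 - d)"
    using d by (simp add: pos_le_divide_eq mult.commute)
qed (rule x)

context
  fixes w :: "int \<Rightarrow> int \<Rightarrow> real" and n :: int
  assumes w_nonneg: "\<And>m j. m \<le> j \<Longrightarrow> j < n \<Longrightarrow> 0 \<le> w m j"
    and w_diag: "\<And>m. m < n \<Longrightarrow> w m m < 1"
begin

lemma triangular_op_iterate_nonneg:
  assumes "\<And>j. 0 \<le> f j"
  shows "0 \<le> (triangular_op w n ^^ k) f m"
proof (induction k arbitrary: m)
  case (Suc k)
  then show ?case
    by (auto simp: triangular_op_def intro!: sum_nonneg mult_nonneg_nonneg w_nonneg)
qed (simp add: assms)

lemma summable_triangular_op_iterates:
  assumes f: "\<And>j. 0 \<le> f j" and m: "m \<le> n"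
  shows "summable (\<lambda>k. (triangular_op w n ^^ k) f m)"
  using m
proof (induction m rule: int_down_induct)
  case (less m)
  show ?case
  proof (cases "m = n")
    case True
    \<comment> \<open>At the endpoint only the term \<open>k = 0\<close> can be nonzero, so the
      series is shifted by one.\<close>
    then have "(triangular_op w n ^^ Suc k) f m = 0" for k by (simp add: triangular_op_def)
    then show ?thesis by (subst summable_Suc_iff[symmetric]) simp
  next
    case False
    with less have mn: "m < n" by simp
    show ?thesis
    proof (rule summable_affine_recursion)
      show "(triangular_op w n ^^ Suc k) f m = w m m * (triangular_op w n ^^ k) f m +
          (\<Sum>j = m + 1..n - 1. w m j * (triangular_op w n ^^ k) f j)" for k
        using mn by (simp add: triangular_op_split)
      show "summable (\<lambda>k. \<Sum>j = m + 1..n - 1. w m j * (triangular_op w n ^^ k) f j)"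
        by (intro summable_sum summable_mult less) auto
      show "0 \<le> (\<Sum>j = m + 1..n - 1. w m j * (triangular_op w n ^^ k) f j)" for k
        by (auto intro!: sum_nonneg mult_nonneg_nonneg w_nonneg triangular_op_iterate_nonneg f)
    qed (use mn w_nonneg w_diag f triangular_op_iterate_nonneg in auto)
  qed
qed

text \<open>The term \<open>k = 0\<close> is \<open>f\<close>. In the others one application of the
  operator is pulled out, and its finite sum commutes with the series because the series converges
  at every index involved.\<close>

lemma suminf_triangular_op_iterates:
  assumes f: "\<And>j. 0 \<le> f j" and m: "m \<le> n"
  shows "(\<Sum>k. (triangular_op w n ^^ k) f m) =
    f m + triangular_op w n (\<lambda>j. \<Sum>k. (triangular_op w n ^^ k) f j) m"
proof -
  note summ = summable_triangular_op_iterates[OF f]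
  have "(\<Sum>k. (triangular_op w n ^^ k) f m) = f m + (\<Sum>k. (triangular_op w n ^^ Suc k) f m)"
    using suminf_split_head[OF summ[OF m]] by simp
  also have "(\<Sum>k. (triangular_op w n ^^ Suc k) f m) =
      (\<Sum>k. \<Sum>j = m..n - 1. w m j * (triangular_op w n ^^ k) f j)"
    by (simp add: triangular_op_def)
  also have "\<dots> = (\<Sum>j = m..n - 1. \<Sum>k. w m j * (triangular_op w n ^^ k) f j)"
    by (intro suminf_sum summable_mult summ) auto
  also have "\<dots> = (\<Sum>j = m..n - 1. w m j * (\<Sum>k. (triangular_op w n ^^ k) f j))"
    by (intro sum.cong refl suminf_mult summ) auto
  also have "\<dots> = triangular_op w n (\<lambda>j. \<Sum>k. (triangular_op w n ^^ k) f j) m"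
    by (rule triangular_op_def[symmetric])
  finally show ?thesis .
qed

text \<open>Moving the diagonal term to the left leaves the positive factor
  \<open>1 - w m m\<close>, while the remaining sum is nonpositive by induction from the
  endpoint.\<close>

lemma triangular_op_subfixed_nonpos:
  assumes e: "\<And>m. m \<le> n \<Longrightarrow> e m \<le> triangular_op w n e m" and m: "m \<le> n"
  shows "e m \<le> 0"
  using m
proof (induction m rule: int_down_induct)
  case (less m)
  show ?case
  proof (cases "m = n")
    case True
    then show ?thesis using e[of m] by (simp add: triangular_op_def)
  next
    case False
    with less have mn: "m < n" by simp
    have "(\<Sum>j = m + 1..n - 1. w m j * e j) \<le> 0"
      by (auto intro!: sum_nonpos mult_nonneg_nonpos w_nonneg less)
    then have "(1 - w m m) * e m \<le> 0"
      using e[of m] mn by (simp add: triangular_op_split algebra_simps)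
    then show ?thesis using w_diag[OF mn] by (simp add: mult_le_0_iff)
  qed
qed

lemma triangular_op_gronwall:
  assumes f: "\<And>j. 0 \<le> f j" and m: "m \<le> n"
    and u: "\<And>m. m \<le> n \<Longrightarrow> u m \<le> c * f m + triangular_op w n u m"
  shows "u m \<le> c * (\<Sum>k. (triangular_op w n ^^ k) f m)"
proof -
  define S where "S m = (\<Sum>k. (triangular_op w n ^^ k) f m)" for m
  have "u m - c * S m \<le> triangular_op w n (\<lambda>j. u j - c * S j) m" if "m \<le> n" for m
  proof -
    have "S m = f m + triangular_op w n S m"
      using suminf_triangular_op_iterates[OF f that] unfolding S_def by simp
    moreover have "triangular_op w n (\<lambda>j. u j - c * S j) m =
        triangular_op w n u m - c * triangular_op w n S m"
      by (simp add: triangular_op_def sum_subtractf sum_distrib_left algebra_simps)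
    ultimately show ?thesis using u[OF that] by (simp add: algebra_simps)
  qed
  from triangular_op_subfixed_nonpos[OF this m] show ?thesis by (simp add: S_def)
qed

end

section \<open>Positivity of the \<open>q\<close>-factorial and the \<open>q\<close>-Gamma
  function\<close>

text \<open>Here \<open>r\<close> is the ratio \<open>s / t\<close>. Since
  \<open>\<alpha> > 0\<close>, the denominators are at least \<open>1 - q powr \<alpha> > 0\<close>,
  so the factors differ from 1 by at most a geometric sequence. Convergence comes first, since
  \<open>prodinf\<close> is informative only then.\<close>

lemma q_product_convergent_pos:
  fixes q \<alpha> r :: real
  assumes q: "0 < q" "q < 1" and "0 < \<alpha>" and r: "0 \<le> r" "r \<le> 1"
  defines "P \<equiv> \<lambda>i. (1 - r * q * q ^ i) / (1 - r * q * q powr (real i + (\<alpha> - 1)))"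
  shows "convergent_prod P" and "0 < prodinf P"
proof -
  have shift: "q * q powr (real i + (\<alpha> - 1)) = q powr \<alpha> * q ^ i" for i
    using q by (simp add: powr_add powr_diff powr_realpow)
  have qa: "0 < q powr \<alpha>" "q powr \<alpha> < 1" using q \<open>0 < \<alpha>\<close> powr01_less_one[of q \<alpha>] by auto
  have qi: "0 < q ^ i" "q ^ i \<le> 1" for i using q by (auto simp: power_le_one)
  have P: "P i = (1 - r * q * q ^ i) / (1 - r * (q powr \<alpha> * q ^ i))" for i
    using shift[of i] by (simp add: P_def mult.assoc)
  have den: "1 - q powr \<alpha> \<le> 1 - r * (q powr \<alpha> * q ^ i)" for i
    using mult_mono[of r 1 "q powr \<alpha> * q ^ i" "q powr \<alpha>"] r qa qi[of i] by (simp add: mult_left_le)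
  have num: "0 < 1 - r * q * q ^ i" for i
  proof -
    have "r * q * q ^ i \<le> 1 * q * 1" using r q qi[of i] by (intro mult_mono) auto
    then show ?thesis using q by linarith
  qed
  have pos: "0 < P i" for i unfolding P using num[of i] den[of i] qa by (intro divide_pos_pos) linarith+
  have "summable (\<lambda>i. norm (P i - 1))"
  proof (rule summable_comparison_test')
    show "summable (\<lambda>i. 1 / (1 - q powr \<alpha>) * q ^ i)"
      using q by (intro summable_mult summable_geometric) auto
    fix i :: nat
    let ?D = "1 - r * (q powr \<alpha> * q ^ i)"
    have D: "0 < ?D" using den[of i] qa by linarith
    have "P i - 1 = (1 - r * q * q ^ i - ?D) / ?D"
      unfolding P diff_divide_distrib[of _ ?D] divide_self[OF less_imp_neq[OF D, symmetric]] ..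
    also have "1 - r * q * q ^ i - ?D = r * (q powr \<alpha> - q) * q ^ i"
      by (simp add: algebra_simps)
    finally have "P i - 1 = r * (q powr \<alpha> - q) * q ^ i / ?D" .
    then have "\<bar>P i - 1\<bar> = r * \<bar>q powr \<alpha> - q\<bar> * q ^ i / ?D"
      using D r qi[of i] by (simp add: abs_mult)
    \<comment> \<open>Both \<open>q powr \<alpha>\<close> and \<open>q\<close> lie between 0 and
      1.\<close>
    moreover have "\<bar>q powr \<alpha> - q\<bar> \<le> 1" using qa q by linarith
    then have "r * \<bar>q powr \<alpha> - q\<bar> * q ^ i / ?D \<le> 1 * 1 * q ^ i / (1 - q powr \<alpha>)"
      using r qa q qi[of i] den[of i] by (intro frac_le mult_mono) auto
    ultimately have "\<bar>P i - 1\<bar> \<le> 1 * 1 * q ^ i / (1 - q powr \<alpha>)" by (simp only:)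
    then show "norm (norm (P i - 1)) \<le> 1 / (1 - q powr \<alpha>) * q ^ i" by simp
  qed
  then show conv: "convergent_prod P"
    by (simp add: abs_convergent_prod_conv_summable abs_convergent_prod_imp_convergent_prod)
  show "0 < prodinf P"
    by (rule has_prod_pos[OF convergent_prod_has_prod[OF conv] pos])
qed

text \<open>The ratio \<open>s / t\<close> is \<open>q powi (j - m)\<close>, so the infinite product
  depends only on \<open>j - m\<close>. In particular, all diagonal products agree with the one in
  \<open>q_Gamma\<close>, where \<open>m = j = 0\<close>.\<close>

lemma q_factorial_eq:
  assumes "0 < q" "q < 1"
  shows "q_factorial q (q powi m) (q * q powi j) \<beta> = (q powi m) powr \<beta> *
    (\<Prod>i. (1 - q powi (j - m) * q * q ^ i) / (1 - q powi (j - m) * q * q powr (real i + \<beta>)))"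
  using assms by (simp add: q_factorial_def power_int_diff mult.commute)

lemma q_factorial_pos:
  assumes "0 < q" "q < 1" "0 < \<alpha>" "m \<le> j"
  shows "0 < q_factorial q (q powi m) (q * q powi j) (\<alpha> - 1)"
proof -
  have "0 \<le> q powi (j - m)" "q powi (j - m) \<le> 1"
    using assms by (auto simp: power_int_def power_le_one)
  from q_product_convergent_pos(2)[OF assms(1-3) this] show ?thesis
    using assms by (simp add: q_factorial_eq)
qed

lemma q_Gamma_pos:
  assumes "0 < q" "q < 1" "0 < \<alpha>"
  shows "0 < q_Gamma q \<alpha>"
  using q_factorial_pos[OF assms, of 0 0] assms by (simp add: q_Gamma_def)

section \<open>The kernel of \<open>q_Omega\<close> in the exponents of \<open>q\<close>\<close>

text \<open>This is the matrix entry of \<open>q_Omega\<close> in the row of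
  \<open>t = q powi m\<close> and the column of \<open>s = q powi j\<close>, with the integration
  weight and the multiplier \<open>x\<close> absorbed.\<close>

definition q_kernel :: "real \<Rightarrow> real \<Rightarrow> (real \<Rightarrow> real) \<Rightarrow> int \<Rightarrow> int \<Rightarrow> real" where
  "q_kernel q \<alpha> x m j = (1 - q) * q powi j * q_factorial q (q powi m) (q * q powi j) (\<alpha> - 1) /
     q_Gamma q \<alpha> * x (q powi j)"

lemma q_kernel_diag:
  assumes q: "0 < q" "q < 1" and "0 < \<alpha>"
  shows "q_kernel q \<alpha> x m m = ((q powi m) powr \<alpha> * (1 - q) powr \<alpha>) * x (q powi m)"
proof -
  have pos: "0 < q powi m" "0 < 1 - q" using q by auto
  \<comment> \<open>The instance \<open>m = j = 0\<close> expresses the common infinite product as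
    \<open>(1 - q) powr (\<alpha> - 1) * q_Gamma q \<alpha>\<close>, and the Gamma factor then
    cancels in the kernel.\<close>
  have "q_factorial q (q powi m) (q * q powi m) (\<alpha> - 1) =
      (q powi m) powr (\<alpha> - 1) * ((1 - q) powr (\<alpha> - 1) * q_Gamma q \<alpha>)"
    using q q_factorial_eq[of q m m "\<alpha> - 1"] q_factorial_eq[of q 0 0 "\<alpha> - 1"]
    by (simp add: q_Gamma_def)
  then have "q_kernel q \<alpha> x m m = (q powi m * (q powi m) powr (\<alpha> - 1)) *
      ((1 - q) * (1 - q) powr (\<alpha> - 1)) * x (q powi m)"
    using q_Gamma_pos[OF assms] by (simp add: q_kernel_def)
  also have "q powi m * (q powi m) powr (\<alpha> - 1) = (q powi m) powr \<alpha>"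
    using pos by (subst powr_mult_base) auto
  also have "(1 - q) * (1 - q) powr (\<alpha> - 1) = (1 - q) powr \<alpha>"
    using pos by (subst powr_mult_base) auto
  finally show ?thesis .
qed

lemma q_Omega_powi:
  assumes "0 < q" "q < 1"
  shows "q_Omega q (q powi n) \<alpha> x \<phi> (q powi m) =
    triangular_op (q_kernel q \<alpha> x) n (\<lambda>j. \<phi> (q powi j)) m"
  using assms
  by (simp add: q_Omega_def q_fractional_integral_def q_nabla_integral_powi triangular_op_def
      q_kernel_def sum_distrib_left sum_divide_distrib mult_ac)

text \<open>The values of \<open>q_Omega\<close> at powers of \<open>q\<close> use its argument only
  at powers of \<open>q\<close>, so the pointwise correspondence survives iteration.\<close>

lemma q_Omega_iterate_powi:
  assumes "0 < q" "q < 1"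
  shows "(q_Omega q (q powi n) \<alpha> x ^^ k) \<phi> (q powi m) =
    (triangular_op (q_kernel q \<alpha> x) n ^^ k) (\<lambda>j. \<phi> (q powi j)) m"
  by (induction k arbitrary: m) (simp_all add: q_Omega_powi[OF assms])

text \<open>Summability is part of the conclusion because the bound by \<open>suminf\<close> is
  meaningful only for a convergent series.\<close>

theorem theorem3p6:
  fixes q \<alpha> a :: real and n0 :: int and v \<mu> :: "real \<Rightarrow> real"
  assumes q: "0 < q" "q < 1"
    and alpha: "0 < \<alpha>" "\<alpha> \<le> 1"
    and a: "a = q powi n0"
    and v_nonneg: "\<forall>t \<in> q_time_scale q n0. 0 \<le> v t"
    and mu_bounds: "\<forall>t \<in> q_time_scale q n0.
      0 \<le> \<mu> t \<and> \<mu> t < 1 / (t powr \<alpha> * (1 - q) powr \<alpha>)"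
    and v_le: "\<forall>t \<in> q_time_scale q n0.
      v t \<le> v a + q_fractional_integral q a \<alpha> (\<lambda>s. v s * \<mu> s) t"
  shows "\<forall>t \<in> q_time_scale q n0.
    summable (\<lambda>k. (q_Omega q a \<alpha> \<mu> ^^ k) (\<lambda>_. 1) t) \<and>
    v t \<le> v a * (\<Sum>k. (q_Omega q a \<alpha> \<mu> ^^ k) (\<lambda>_. 1) t)"
proof
  fix t assume "t \<in> q_time_scale q n0"
  then obtain m where m: "m \<le> n0" and t: "t = q powi m" by (auto simp: q_time_scale_def)
  let ?w = "q_kernel q \<alpha> \<mu>"
  have scale: "q powi j \<in> q_time_scale q n0" if "j \<le> n0" for j
    using that by (auto simp: q_time_scale_def)
  have w_nonneg: "0 \<le> ?w i j" if "i \<le> j" "j < n0" for i j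
    using that q q_factorial_pos[OF q alpha(1) that(1)] q_Gamma_pos[OF q alpha(1)] mu_bounds
      scale[of j]
    by (auto simp: q_kernel_def)
  have w_diag: "?w j j < 1" if "j < n0" for j
  proof -
    \<comment> \<open>This factor is the diagonal entry without \<open>\<mu>\<close>. Being
      positive, it can be multiplied across the upper bound on \<open>\<mu>\<close>.\<close>
    have "0 < (q powi j) powr \<alpha> * (1 - q) powr \<alpha>" using q by simp
    moreover have "\<mu> (q powi j) < 1 / ((q powi j) powr \<alpha> * (1 - q) powr \<alpha>)"
      using mu_bounds scale[of j] that by simp
    ultimately show ?thesis
      by (simp only: q_kernel_diag[OF q alpha(1)] pos_less_divide_eq mult.commute)
  qed
  have "summable (\<lambda>k. (triangular_op ?w n0 ^^ k) (\<lambda>_. 1) m)"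
    by (rule summable_triangular_op_iterates[OF w_nonneg w_diag _ m]) simp_all
  \<comment> \<open>The abstract inequality is applied with \<open>f = 1\<close> and
    \<open>c = v a\<close>; the operator acting on \<open>v\<close> is the fractional integral of
    \<open>v * \<mu>\<close>.\<close>
  moreover have "v (q powi m) \<le> v a * (\<Sum>k. (triangular_op ?w n0 ^^ k) (\<lambda>_. 1) m)"
  proof (rule triangular_op_gronwall[OF w_nonneg w_diag _ m])
    fix i assume "i \<le> n0"
    then have "v (q powi i) \<le> v a + q_Omega q a \<alpha> \<mu> v (q powi i)"
      using v_le scale[of i] by (simp add: q_Omega_def mult.commute)
    then show "v (q powi i) \<le> v a * 1 + triangular_op ?w n0 (\<lambda>j. v (q powi j)) i"
      by (simp add: a q_Omega_powi[OF q])
  qed simp_all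
  ultimately show "summable (\<lambda>k. (q_Omega q a \<alpha> \<mu> ^^ k) (\<lambda>_. 1) t) \<and>
      v t \<le> v a * (\<Sum>k. (q_Omega q a \<alpha> \<mu> ^^ k) (\<lambda>_. 1) t)"
    unfolding t unfolding a q_Omega_iterate_powi[OF q] by simp
qed

end
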